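(* Let $n\ge 1$ and $0\le k\le n-1$ be integers. The number of nilpotent $k$-file placements on $[n]\times[n]$ is equal to $\binom{n-1}{k}\,n^{k}$.
   Context: Write $[n]=\{1,\dots,n\}$. A file placement (partial transformation) on $[n]$ is a function $f:A\to[n]$ defined on a subset $A\subseteq[n]$; it is a $k$-file placement if $|A|=k$. Its digraph has vertex set $[n]$ and a directed edge $i\to f(i)$ for each $i\in A$. The file placement $f$ is nilpotent if its digraph has no directed cycle (loops count as cycles); equivalently, after extending $f$ to $\{0,1,\dots,n\}$ by $f(i)=0$ for $i\notin A$, some iterate of $f$ is identically $0$. *)

theory Defs
  imports "Graph_Theory.Arc_Walk"
begin

definition file_placements :: "nat \<Rightarrow> nat \<Rightarrow> (nat \<rightharpoonup> nat) set" where
  "file_placements n k =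
     {f. dom f \<subseteq> {1..n} \<and> ran f \<subseteq> {1..n} \<and> card (dom f) = k}"

definition placement_digraph :: "nat \<Rightarrow> (nat \<rightharpoonup> nat) \<Rightarrow> (nat, nat \<times> nat) pre_digraph" where
  "placement_digraph n f =
     \<lparr> verts = {1..n}, arcs = {(i, j). f i = Some j}, tail = fst, head = snd \<rparr>"

(* pre_digraph.cycle admits cycles of every positive length, so a loop is a cycle. *)
definition nilpotent_placement :: "nat \<Rightarrow> (nat \<rightharpoonup> nat) \<Rightarrow> bool" where
  "nilpotent_placement n f \<longleftrightarrow> (\<nexists>p. pre_digraph.cycle (placement_digraph n f) p)"

end

theory Submission
  imports Defs
begin

text \<open>
  Double counting of pairs of a nilpotent placement with \<open>k + 1\<close> arcs and one of its arcs, in the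
  manner of Pitman's proof of Cayley's formula. Deleting the arc leaves a nilpotent placement with
  \<open>k\<close> arcs, whose digraph is a forest of \<open>n - k\<close> trees rooted at the vertices outside the domain.
  Conversely an arc \<open>i \<rightarrow> j\<close> may be added exactly when \<open>i\<close> is one of the \<open>n - k - 1\<close> roots of the trees
  not containing \<open>j\<close>, while \<open>j\<close> is arbitrary. Hence the numbers \<open>N k\<close> of nilpotent placements satisfy
  \<open>(k + 1) * N (k + 1) = n * (n - 1 - k) * N k\<close>.
\<close>

text \<open>Every closed walk contains a cycle and every cycle is a closed walk; a closed walk at
  \<open>u\<close> is a nonempty walk from \<open>u\<close> back to itself.\<close>

lemma (in wf_digraph) no_cycle_iff_acyclic: "(\<nexists>p. cycle p) \<longleftrightarrow> acyclic (arcs_ends G)"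
proof -
  have "(\<exists>p. cycle p) \<longleftrightarrow> (\<exists>p. closed_w p)"
    using closed_w_imp_cycle cycle_altdef by blast
  also have "\<dots> \<longleftrightarrow> (\<exists>u. u \<rightarrow>\<^sup>+ u)"
    by (auto simp: closed_w_def reachable1_awalk)
  finally show ?thesis
    by (auto simp: acyclic_def)
qed

lemma single_valued_graph: "single_valued (Map.graph f)"
  by (auto simp: single_valued_def Map.graph_def)

text \<open>As \<open>i\<close> had no outgoing arc, the update only adds the pair
  \<open>(i, j)\<close>. A cycle through it consists of this arc and a path from \<open>j\<close>
  back to \<open>i\<close>; the empty path accounts for loops.\<close>

lemma acyclic_graph_map_upd:
  assumes "i \<notin> dom f"
  shows "acyclic (Map.graph (f(i \<mapsto> j))) \<longleftrightarrow>
           acyclic (Map.graph f) \<and> (j, i) \<notin> (Map.graph f)\<^sup>*"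
proof -
  have "Map.graph (f(i \<mapsto> j)) = insert (i, j) (Map.graph f)"
    using assms by (auto simp: Map.graph_def split: if_splits)
  then show ?thesis
    by (simp add: acyclic_insert)
qed

text \<open>This \<open>i\<close> is the root of the tree containing \<open>j\<close>. Following
  \<open>f\<close> from \<open>j\<close> must stop, since a finite acyclic relation has a
  well-founded converse. Two stopping points coincide because a single-valued relation makes them
  comparable and no path leaves a root.\<close>

lemma ex1_root:
  assumes "acyclic (Map.graph f)" and "finite (dom f)"
  shows "\<exists>!i. i \<notin> dom f \<and> (j, i) \<in> (Map.graph f)\<^sup>*"
proof (rule ex_ex1I)
  have "wf ((Map.graph f)\<inverse>)"
    using assms by (simp add: finite_acyclic_wf_converse)
  then show "\<exists>i. i \<notin> dom f \<and> (j, i) \<in> (Map.graph f)\<^sup>*"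
  proof (induction j rule: wf_induct_rule)
    case (less j)
    show ?case
    proof (cases "f j")
      case None
      then show ?thesis by blast
    next
      case (Some j')
      then have "(j, j') \<in> Map.graph f"
        by (simp add: Map.graph_def)
      with less show ?thesis
        by (meson converse_iff converse_rtrancl_into_rtrancl)
    qed
  qed
next
  have sink: "x = y" if "x \<notin> dom f" "(x, y) \<in> (Map.graph f)\<^sup>*" for x y
    using that(2,1) by (cases rule: converse_rtranclE) (auto simp: Map.graph_def)
  fix i i'
  assume "i \<notin> dom f \<and> (j, i) \<in> (Map.graph f)\<^sup>*" "i' \<notin> dom f \<and> (j, i') \<in> (Map.graph f)\<^sup>*"
  then show "i = i'"
    using single_valued_confluent[OF single_valued_graph] sink by metis
qed

lemma nilpotent_placement_iff_acyclic:
  assumes "dom f \<subseteq> {1..n}" and "ran f \<subseteq> {1..n}"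
  shows "nilpotent_placement n f \<longleftrightarrow> acyclic (Map.graph f)"
proof -
  interpret wf_digraph "placement_digraph n f"
    using assms by unfold_locales (auto simp: placement_digraph_def ran_def)
  have "arcs_ends (placement_digraph n f) = Map.graph f"
    by (auto simp: arcs_ends_conv placement_digraph_def Map.graph_def)
  then show ?thesis
    using no_cycle_iff_acyclic by (simp add: nilpotent_placement_def)
qed

definition nilpotent_placements :: "nat \<Rightarrow> nat \<Rightarrow> (nat \<rightharpoonup> nat) set" where
  "nilpotent_placements n k = {f \<in> file_placements n k. nilpotent_placement n f}"

lemma nilpotent_placements_iff:
  "f \<in> nilpotent_placements n k \<longleftrightarrow>
     dom f \<subseteq> {1..n} \<and> ran f \<subseteq> {1..n} \<and> card (dom f) = k \<and> acyclic (Map.graph f)"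
  using nilpotent_placement_iff_acyclic[of f n]
  by (auto simp: nilpotent_placements_def file_placements_def)

lemma finite_nilpotent_placements: "finite (nilpotent_placements n k)"
proof -
  have "nilpotent_placements n k \<subseteq> (\<Union>A\<in>Pow {1..n}. {f. dom f = A \<and> ran f \<subseteq> {1..n}})"
    unfolding nilpotent_placements_def file_placements_def by blast
  moreover have "finite {f :: nat \<rightharpoonup> nat. dom f = A \<and> ran f \<subseteq> {1..n}}" if "A \<subseteq> {1..n}" for A
    using that finite_set_of_finite_maps finite_subset[of A "{1..n}"] by blast
  then have "finite (\<Union>A\<in>Pow {1..n}. {f :: nat \<rightharpoonup> nat. dom f = A \<and> ran f \<subseteq> {1..n}})"
    by simp
  ultimately show ?thesis
    by (rule finite_subset)
qed

lemma nilpotent_placements_0: "nilpotent_placements n 0 = {Map.empty}"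
proof -
  have "card (dom f) = 0 \<longleftrightarrow> f = Map.empty" if "dom f \<subseteq> {1..n}" for f :: "nat \<rightharpoonup> nat"
    using that finite_subset by fastforce
  then show ?thesis
    by (auto simp: nilpotent_placements_iff acyclic_def Map.graph_def)
qed

text \<open>These are the arcs whose addition keeps \<open>f\<close> a nilpotent placement;
  reflexivity of the closure rules out \<open>i = j\<close>.\<close>

definition free_arcs :: "nat \<Rightarrow> (nat \<rightharpoonup> nat) \<Rightarrow> (nat \<times> nat) set" where
  "free_arcs n f =
     {(i, j). i \<in> {1..n} - dom f \<and> j \<in> {1..n} \<and> (j, i) \<notin> (Map.graph f)\<^sup>*}"

lemma card_free_arcs:
  assumes "f \<in> nilpotent_placements n k"
  shows "card (free_arcs n f) = n * (n - 1 - k)"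
proof -
  from assms have dom: "dom f \<subseteq> {1..n}" and ran: "ran f \<subseteq> {1..n}"
    and card: "card (dom f) = k" and acyclic: "acyclic (Map.graph f)"
    by (auto simp: nilpotent_placements_iff)
  have fin: "finite (dom f)"
    using dom finite_subset by blast
  \<comment> \<open>For a fixed head \<open>j\<close>, the admissible tails are the
    \<open>n - k\<close> roots except the root \<open>r\<close> of the tree of
    \<open>j\<close>.\<close>
  have fibre: "card {i \<in> {1..n} - dom f. (j, i) \<notin> (Map.graph f)\<^sup>*} = n - 1 - k"
    if j: "j \<in> {1..n}" for j
  proof -
    obtain r where r: "r \<notin> dom f" "(j, r) \<in> (Map.graph f)\<^sup>*"
      and uniq: "\<And>i. i \<notin> dom f \<Longrightarrow> (j, i) \<in> (Map.graph f)\<^sup>* \<Longrightarrow> i = r"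
      using ex1_root[OF acyclic fin, of j] by metis
    \<comment> \<open>\<open>r\<close> is either \<open>j\<close> itself or a value of
      \<open>f\<close>.\<close>
    have "r \<in> {1..n}"
      using r(2) j ran by (cases rule: rtranclE) (auto simp: Map.graph_def ran_def)
    then have "card ({1..n} - dom f - {r}) = n - k - 1"
      using r dom fin card by (simp add: card_Diff_subset)
    moreover have "{i \<in> {1..n} - dom f. (j, i) \<notin> (Map.graph f)\<^sup>*} = {1..n} - dom f - {r}"
      using r uniq by blast
    ultimately show ?thesis
      by simp
  qed
  \<comment> \<open>The fibres are taken over heads, whereas the pairs list the tail first, hence
    the swap.\<close>
  have "free_arcs n f =
      prod.swap ` (SIGMA j:{1..n}. {i \<in> {1..n} - dom f. (j, i) \<notin> (Map.graph f)\<^sup>*})"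
    by (auto simp: free_arcs_def)
  then show ?thesis
    using fibre by (simp add: card_image)
qed

lemma map_upd_mem_nilpotent_placements:
  assumes "f \<in> nilpotent_placements n k" and "(i, j) \<in> free_arcs n f"
  shows "f(i \<mapsto> j) \<in> nilpotent_placements n (Suc k)"
proof -
  have "finite (dom f)"
    using assms(1) finite_subset by (auto simp: nilpotent_placements_iff)
  then show ?thesis
    using assms acyclic_graph_map_upd[of i f j]
    by (auto simp: nilpotent_placements_iff free_arcs_def domIff)
qed

lemma map_del_mem_nilpotent_placements:
  assumes "g \<in> nilpotent_placements n (Suc k)" and "g i = Some j"
  shows "g(i := None) \<in> nilpotent_placements n k" and "(i, j) \<in> free_arcs n (g(i := None))"
proof -
  have g: "g = (g(i := None))(i \<mapsto> j)"
    using assms(2) by auto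
  from assms have dom: "dom g \<subseteq> {1..n}" "i \<in> dom g" and ran: "ran g \<subseteq> {1..n}" "j \<in> ran g"
    and card: "card (dom g) = Suc k" and "acyclic (Map.graph g)"
    by (auto simp: nilpotent_placements_iff ran_def)
  then have "acyclic (Map.graph (g(i := None))) \<and> (j, i) \<notin> (Map.graph (g(i := None)))\<^sup>*"
    using acyclic_graph_map_upd[of i "g(i := None)" j] g by (metis domIff fun_upd_same)
  moreover have "ran (g(i := None)) \<subseteq> {1..n}"
    using ran by (auto simp: ran_def split: if_splits)
  moreover have "card (dom (g(i := None))) = k"
    using card dom by simp
  ultimately show "g(i := None) \<in> nilpotent_placements n k"
    and "(i, j) \<in> free_arcs n (g(i := None))"
    using dom ran by (auto simp: nilpotent_placements_iff free_arcs_def)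
qed

lemma card_nilpotent_placements_Suc:
  "Suc k * card (nilpotent_placements n (Suc k)) =
     n * (n - 1 - k) * card (nilpotent_placements n k)"
proof -
  let ?A = "SIGMA g:nilpotent_placements n (Suc k). dom g"
  let ?B = "SIGMA f:nilpotent_placements n k. free_arcs n f"
  \<comment> \<open>An arc of \<open>g\<close> is determined by its tail \<open>i\<close>, so it is
    recorded as an element of \<open>dom g\<close>. Deleting it undoes its addition because
    \<open>f i = None\<close> for a free arc.\<close>
  have "bij_betw (\<lambda>(g, i). (g(i := None), i, the (g i))) ?A ?B"
  proof (rule bij_betw_byWitness[where f' = "\<lambda>(f, i, j). (f(i \<mapsto> j), i)"])
    show "(\<lambda>(g, i). (g(i := None), i, the (g i))) ` ?A \<subseteq> ?B"
      using map_del_mem_nilpotent_placements by fastforce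
    show "(\<lambda>(f, i, j). (f(i \<mapsto> j), i)) ` ?B \<subseteq> ?A"
      using map_upd_mem_nilpotent_placements by fastforce
  qed (auto simp: free_arcs_def domIff)
  then have "card ?A = card ?B"
    by (rule bij_betw_same_card)
  moreover have "card (dom g) = Suc k" "finite (dom g)" if "g \<in> nilpotent_placements n (Suc k)" for g
    using that finite_subset by (auto simp: nilpotent_placements_iff)
  moreover have "finite (free_arcs n f)" for f
    by (rule finite_subset[of _ "{1..n} \<times> {1..n}"]) (auto simp: free_arcs_def)
  ultimately show ?thesis
    using finite_nilpotent_placements by (simp add: card_SigmaI card_free_arcs mult_ac)
qed

lemma card_nilpotent_placements:
  "card (nilpotent_placements n k) = ((n - 1) choose k) * n ^ k"
proof (induction k)
  case 0
  show ?case
    by (simp add: nilpotent_placements_0)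
next
  case (Suc k)
  have "Suc k * card (nilpotent_placements n (Suc k)) =
      ((n - 1 - k) * ((n - 1) choose k)) * n ^ Suc k"
    by (simp only: card_nilpotent_placements_Suc Suc.IH power_Suc mult_ac)
  \<comment> \<open>Both sides equal \<open>(n - 1) * ((n - 1 - 1) choose k)\<close>.\<close>
  also have "(n - 1 - k) * ((n - 1) choose k) = Suc k * ((n - 1) choose Suc k)"
    by (simp only: binomial_absorb_comp binomial_absorption)
  finally have "Suc k * card (nilpotent_placements n (Suc k)) =
      Suc k * (((n - 1) choose Suc k) * n ^ Suc k)"
    by (simp only: mult.assoc)
  \<comment> \<open>The common factor \<open>Suc k\<close> is nonzero and cancels.\<close>
  then show ?case
    by (simp only: mult_cancel1) simp
qed

theorem theorem3p3:
  fixes n k :: nat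
  assumes "n \<ge> 1" and "k \<le> n - 1"
  shows "card {f \<in> file_placements n k. nilpotent_placement n f} = ((n - 1) choose k) * n ^ k"
  using card_nilpotent_placements[of n k] by (simp add: nilpotent_placements_def)

end
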